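(* Let $0<\beta<1$ and $d_1,d_2>0$ be constants (not depending on $n$) with $\beta\le\frac14$. Then there exist a constant $D>0$ and an integer $n_0$, neither depending on $n$, such that for every $n\ge n_0$, every $p=p(n)$ with $\frac{\log n}{\sqrt n}\le p<1$, and every edge probability assignment $\{p(u,v)\}_{1\le u<v\le n}$ that is $(\beta,d_1,d_2,p)$-nice, the random graph $G$ on $\{1,\dots,n\}$ with these edge probabilities satisfies $$\mathbb{P}(E_{PER})\ \ge\ 1-e^{-D(\log n)^2},$$ where $E_{PER}$ is the event that $G$ contains a perfect matching.
   Context: Random graph: let $K_n$ be the complete graph on the vertex set $\{1,\dots,n\}$. An edge probability assignment is a family of numbers $p(u,v)\in[0,1]$, $1\le u<v\le n$, extended symmetrically by $p(v,u)=p(u,v)$. Let $\{Z(f)\}_{f\in K_n}$ be independent random variables indexed by the edges of $K_n$, where for $f=(u,v)$ we have $\mathbb{P}(Z(f)=1)=p(u,v)=1-\mathbb{P}(Z(f)=0)$. The random graph $G$ has vertex set $\{1,\dots,n\}$ and consists of all edges $f$ with $Z(f)=1$. Nice assignments: for constants $0<\beta<1$, $d_1,d_2>0$ and $0<p=p(n)<1$, the assignment $\{p(u,v)\}$ is $(\beta,d_1,d_2,p)$-nice if the following holds for any two distinct vertices $u,v$: for any two disjoint sets of vertices $S_1,S_2$, neither containing $u$ or $v$, and having the same cardinality $r\ge\beta n$ each, $$\sum_{w\in S_1}p(u,w)\ \ge\ d_1 r p\qquad\text{and}\qquad \sum_{w_1\in S_1,\,w_2\in S_2}p(u,w_1)\,p(w_2,v)\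 \ge\ d_2 r p^2,$$ where the second sum runs over all pairs $(w_1,w_2)\in S_1\times S_2$. Perfect matching: a matching of $G$ is a set of vertex-disjoint edges of $G$. A matching $\mathcal{W}$ is perfect if every vertex of $G$, except at most one, is an endvertex of some edge in $\mathcal{W}$ (so $n$ may be odd). *)

theory Defs
  imports "HOL-Probability.Product_PMF"
begin

definition complete_edges :: "nat \<Rightarrow> nat set set" where
  "complete_edges n = {{u, v} | u v. u \<in> {1..n} \<and> v \<in> {1..n} \<and> u \<noteq> v}"

text \<open>Only the values of \<open>q\<close> at distinct vertices of \<open>{1..n}\<close> are constrained.\<close>

definition edge_prob_assignment :: "nat \<Rightarrow> (nat \<Rightarrow> nat \<Rightarrow> real) \<Rightarrow> bool" where
  "edge_prob_assignment n q \<longleftrightarrow>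
     (\<forall>u\<in>{1..n}. \<forall>v\<in>{1..n}. u \<noteq> v \<longrightarrow> 0 \<le> q u v \<and> q u v \<le> 1 \<and> q v u = q u v)"

text \<open>The joint law of the independent edge indicators \<open>Z\<close>. For \<open>f = {u, v}\<close> with \<open>u < v\<close>
  the success probability is \<open>q u v\<close>, because \<open>Min f = u\<close> and \<open>Max f = v\<close>.\<close>

definition edge_indicators :: "nat \<Rightarrow> (nat \<Rightarrow> nat \<Rightarrow> real) \<Rightarrow> (nat set \<Rightarrow> bool) pmf" where
  "edge_indicators n q =
     Pi_pmf (complete_edges n) False (\<lambda>f. bernoulli_pmf (q (Min f) (Max f)))"

text \<open>The vertex set is always \<open>{1..n}\<close>, so that a graph is given by its set of edges.\<close>

definition random_graph :: "nat \<Rightarrow> (nat \<Rightarrow> nat \<Rightarrow> real) \<Rightarrow> nat set set pmf" where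
  "random_graph n q = map_pmf (\<lambda>Z. {f \<in> complete_edges n. Z f}) (edge_indicators n q)"

definition nice ::
  "nat \<Rightarrow> real \<Rightarrow> real \<Rightarrow> real \<Rightarrow> real \<Rightarrow> (nat \<Rightarrow> nat \<Rightarrow> real) \<Rightarrow> bool" where
  "nice n \<beta> d1 d2 p q \<longleftrightarrow>
     (\<forall>u\<in>{1..n}. \<forall>v\<in>{1..n}. u \<noteq> v \<longrightarrow>
       (\<forall>S1 S2 r. S1 \<subseteq> {1..n} - {u, v} \<and> S2 \<subseteq> {1..n} - {u, v} \<and> S1 \<inter> S2 = {} \<and>
          card S1 = r \<and> card S2 = r \<and> \<beta> * real n \<le> real r \<longrightarrow>
            d1 * real r * p \<le> (\<Sum>w\<in>S1. q u w) \<and>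
            d2 * real r * p\<^sup>2 \<le> (\<Sum>(w1, w2)\<in>S1 \<times> S2. q u w1 * q w2 v)))"

definition matching :: "nat set set \<Rightarrow> nat set set \<Rightarrow> bool" where
  "matching G W \<longleftrightarrow> W \<subseteq> G \<and> (\<forall>e\<in>W. \<forall>f\<in>W. e \<noteq> f \<longrightarrow> e \<inter> f = {})"

definition perfect_matching :: "nat \<Rightarrow> nat set set \<Rightarrow> nat set set \<Rightarrow> bool" where
  "perfect_matching n G W \<longleftrightarrow> matching G W \<and> card {v \<in> {1..n}. \<forall>e\<in>W. v \<notin> e} \<le> 1"

definition E_PER :: "nat \<Rightarrow> nat set set set" where
  "E_PER n = {G. \<exists>W. perfect_matching n G W}"

lemma finite_complete_edges: "finite (complete_edges n)"
proof -
  have "complete_edges n \<subseteq> Pow {1..n}"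
    by (auto simp: complete_edges_def)
  then show ?thesis
    by (rule finite_subset) simp
qed

lemma prob_edge_in_random_graph:
  assumes q: "edge_prob_assignment n q"
    and uv: "u \<in> {1..n}" "v \<in> {1..n}" "u \<noteq> v"
  shows "measure_pmf.prob (random_graph n q) {G. {u, v} \<in> G} = q u v"
proof -
  let ?f = "{u, v}"
  have f: "?f \<in> complete_edges n"
    using uv by (auto simp: complete_edges_def)
  have qf: "q (Min ?f) (Max ?f) = q u v" "0 \<le> q u v" "q u v \<le> 1"
    using q uv by (auto simp: edge_prob_assignment_def min_def max_def)
  have "measure_pmf.prob (random_graph n q) {G. ?f \<in> G}
      = measure_pmf.prob (map_pmf (\<lambda>Z. Z ?f) (edge_indicators n q)) {True}"
    using f by (simp add: random_graph_def vimage_def)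
  also have "map_pmf (\<lambda>Z. Z ?f) (edge_indicators n q) = bernoulli_pmf (q u v)"
    unfolding edge_indicators_def
    by (subst Pi_pmf_component[OF finite_complete_edges]) (simp only: f qf(1) if_True)
  finally show ?thesis
    using qf by (simp add: measure_pmf_single)
qed

lemma indep_edge_indicators:
  "prob_space.indep_vars (measure_pmf (edge_indicators n q)) (\<lambda>_. count_space UNIV)
     (\<lambda>f Z. Z f) (complete_edges n)"
  unfolding edge_indicators_def by (rule indep_vars_Pi_pmf[OF finite_complete_edges])

end

theory Submission
  imports Defs "HOL-Real_Asymp.Real_Asymp"
begin

text \<open>
  Niceness says that every vertex \<open>u\<close> has average edge probability at least \<open>d1 p\<close> into every set
  of at least \<open>\<beta> n\<close> vertices. Hence the vertices \<open>w\<close> with \<open>q u w < d1 p\<close> number fewer than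
  \<open>\<beta> n \<le> n/4\<close> (\<open>nice_few_weak\<close>): the edges of probability at least \<open>d1 p\<close> form a
  graph of minimum degree about \<open>3n/4\<close>. This density is what makes augmenting paths of length three
  plentiful.

  The graph is exposed in two independent rounds, each of which contains an edge with probability
  at least \<open>q u v / 2\<close> (\<open>indep_bits_two_rounds\<close>). In the first round every fixed set of \<open>n/3\<close>
  vertices contains edges of total expected number at least of order \<open>n\<^sup>2 p\<close>, which is at least of
  order \<open>n powr (3/2) * ln n\<close>. This beats the at most \<open>2 ^ n\<close> choices of the set, so with overwhelming
  probability no set of \<open>n/3\<close> vertices is independent (\<open>prob_large_independent_le\<close>), and then a
  maximal matching covers more than \<open>2n/3\<close> vertices (\<open>ex_large_mates\<close>).

  The second round is independent of this matching \<open>m\<close>, and it absorbs the uncovered vertices two at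
  a time. For uncovered \<open>u\<close> and \<open>v\<close> and covered \<open>w\<close>, the edges \<open>{u, w}\<close> and \<open>{m w, v}\<close> turn
  \<open>{w, m w}\<close> into two edges covering \<open>u\<close> and \<open>v\<close> as well. At most \<open>2 * (n/4)\<close> of the vertices \<open>w\<close>
  are bad for \<open>u\<close> or for \<open>v\<close>, so at least \<open>n/6\<close> of them give such a path with probability
  at least \<open>(d1 p / 2)\<^sup>2\<close>, and these events are independent. All of them fail with probability at
  most \<open>exp (- n/6 * (d1 p / 2)\<^sup>2)\<close>, which is at most \<open>exp (- d1\<^sup>2 / 24 * (ln n)\<^sup>2)\<close> because
  \<open>p \<ge> ln n / sqrt n\<close> (\<open>prob_no_augmenting_path_le\<close>). The edges between \<open>{u, v}\<close> and the covered
  set have not been looked at by earlier steps and lie inside the covered set from then on, so the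
  steps can be iterated (\<open>prob_complete_to_perfect_ge\<close>). There are at most \<open>n\<close> of them, and the factor
  \<open>n\<close> is swallowed by halving the exponent, which leaves \<open>D = d1\<^sup>2 / 48\<close>.
\<close>

section \<open>Random subsets with independent membership\<close>

definition indep_bits :: "'a set \<Rightarrow> ('a \<Rightarrow> real) \<Rightarrow> ('a \<Rightarrow> bool) pmf" where
  "indep_bits E g = Pi_pmf E False (\<lambda>e. bernoulli_pmf (g e))"

text \<open>The union bound for an experiment in two stages: a first stage that goes wrong with probability
at most \<open>\<alpha>\<close>, and a second one that fails with probability at most \<open>\<gamma>\<close> after every good outcome of
the first.\<close>

lemma prob_bind_ge:
  fixes \<alpha> \<gamma> :: real
  assumes bad: "measure_pmf.prob M {x. \<not> P x} \<le> \<alpha>" and "0 \<le> \<gamma>"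
    and good: "\<And>x. P x \<Longrightarrow> measure_pmf.prob (f x) A \<ge> 1 - \<gamma>"
  shows "measure_pmf.prob (bind_pmf M f) A \<ge> 1 - \<alpha> - \<gamma>"
proof -
  have int: "integrable (measure_pmf M) (\<lambda>x. measure_pmf.prob (f x) A)"
    by (rule measure_pmf.integrable_const_bound[where B = 1]) auto
  have "ennreal (measure_pmf.prob (bind_pmf M f) A)
      = (\<integral>\<^sup>+x. ennreal (measure_pmf.prob (f x) A) \<partial>measure_pmf M)"
    by (simp flip: measure_pmf.emeasure_eq_measure)
  also have "\<dots> = ennreal (\<integral>x. measure_pmf.prob (f x) A \<partial>measure_pmf M)"
    by (rule nn_integral_eq_integral[OF int]) simp
  finally have eq: "measure_pmf.prob (bind_pmf M f) A
      = (\<integral>x. measure_pmf.prob (f x) A \<partial>measure_pmf M)"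
    by simp
  have "(\<integral>x. 1 - \<gamma> - indicator {x. \<not> P x} x \<partial>measure_pmf M)
      \<le> (\<integral>x. measure_pmf.prob (f x) A \<partial>measure_pmf M)"
  proof (rule integral_mono[OF _ int])
    show "1 - \<gamma> - indicator {x. \<not> P x} x \<le> measure_pmf.prob (f x) A" for x
      using good[of x] \<open>0 \<le> \<gamma>\<close> measure_nonneg[of "measure_pmf (f x)" A]
      by (cases "P x") (auto simp del: measure_nonneg)
    show "integrable (measure_pmf M) (\<lambda>x. 1 - \<gamma> - indicator {x. \<not> P x} x)"
      by (rule measure_pmf.integrable_const_bound[where B = "\<bar>1 - \<gamma>\<bar> + 1"])
         (auto split: split_indicator)
  qed
  also have "(\<integral>x. 1 - \<gamma> - indicator {x. \<not> P x} x \<partial>measure_pmf M)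
      = 1 - \<gamma> - measure_pmf.prob M {x. \<not> P x}"
    by (subst Bochner_Integration.integral_diff)
       (auto intro: measure_pmf.integrable_const_bound[where B = 1])
  finally show ?thesis
    using bad unfolding eq by simp
qed

lemma bernoulli_two_rounds:
  fixes a b c :: real
  assumes "0 \<le> a" "a \<le> 1" "0 \<le> b" "b \<le> 1" and c: "1 - c = (1 - a) * (1 - b)"
  shows "bernoulli_pmf c = bind_pmf (bernoulli_pmf a) (\<lambda>x. bernoulli_pmf (if x then 1 else b))"
proof (rule pmf_eqI)
  fix y
  have "0 \<le> (1 - a) * (1 - b)" "(1 - a) * (1 - b) \<le> 1"
    using assms by (auto intro!: mult_le_one)
  then have "0 \<le> c" "c \<le> 1"
    using c by auto
  then show "pmf (bernoulli_pmf c) y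
      = pmf (bind_pmf (bernoulli_pmf a) (\<lambda>x. bernoulli_pmf (if x then 1 else b))) y"
    using assms by (cases y) (auto simp: pmf_bind algebra_simps)
qed

text \<open>An element that the first round hits gets probability one in the second, so the second round
ends with the final set, and it is again a family of independent bits. Both exposures in the
argument are instances: halving all probabilities (\<open>a = g / 2\<close>) is sprinkling, and splitting \<open>g\<close>
by a set of elements (\<open>a = g\<close> inside, \<open>b = g\<close> outside) reveals exactly that set.\<close>

lemma indep_bits_two_rounds:
  fixes a b g :: "'a \<Rightarrow> real"
  assumes "finite E"
    and ab: "\<And>e. e \<in> E \<Longrightarrow> 0 \<le> a e \<and> a e \<le> 1 \<and> 0 \<le> b e \<and> b e \<le> 1"
    and g: "\<And>e. e \<in> E \<Longrightarrow> 1 - g e = (1 - a e) * (1 - b e)"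
  shows "indep_bits E g
    = bind_pmf (indep_bits E a) (\<lambda>X. indep_bits E (\<lambda>e. if X e then 1 else b e))"
proof -
  have "indep_bits E g = Pi_pmf E False
      (\<lambda>e. bind_pmf (bernoulli_pmf (a e)) (\<lambda>x. bernoulli_pmf (if x then 1 else b e)))"
    unfolding indep_bits_def using ab g
    by (intro Pi_pmf_cong refl bernoulli_two_rounds) auto
  also have "\<dots> = bind_pmf (indep_bits E a) (\<lambda>X. indep_bits E (\<lambda>e. if X e then 1 else b e))"
    unfolding indep_bits_def by (rule Pi_pmf_bind[OF \<open>finite E\<close>])
  finally show ?thesis .
qed

lemma AE_indep_bits_sure:
  assumes "finite E"
  shows "AE Z in measure_pmf (indep_bits E g). \<forall>e\<in>E. g e = 1 \<longrightarrow> Z e"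
proof -
  have "Z e" if "Z \<in> set_pmf (indep_bits E g)" "e \<in> E" "g e = 1" for Z e
  proof -
    have "Z e \<in> set_pmf (bernoulli_pmf 1)"
      using that assms by (auto simp: indep_bits_def set_Pi_pmf PiE_dflt_def)
    then show "Z e"
      by (cases "Z e") (auto simp: set_pmf_iff)
  qed
  then show ?thesis
    by (auto simp: AE_measure_pmf_iff)
qed

lemma Pi_pmf_disjoint_coords_indep:
  assumes "finite E" "K \<subseteq> E"
    and P: "\<And>Z Z'. (\<And>e. e \<in> K \<Longrightarrow> Z e = Z' e) \<Longrightarrow> P Z = P Z'"
    and Q: "\<And>Z Z'. (\<And>e. e \<in> E - K \<Longrightarrow> Z e = Z' e) \<Longrightarrow> Q Z = Q Z'"
  shows "measure_pmf.prob (Pi_pmf E d p) {Z. P Z \<and> Q Z}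
    = measure_pmf.prob (Pi_pmf E d p) {Z. P Z} * measure_pmf.prob (Pi_pmf E d p) {Z. Q Z}"
proof -
  define A B where "A = Pi_pmf K d p" and "B = Pi_pmf (E - K) d p"
  let ?h = "\<lambda>(f, g) x. if x \<in> K then f x else g x"
  have "Pi_pmf (K \<union> (E - K)) d p = map_pmf ?h (pair_pmf A B)"
    unfolding A_def B_def using assms(1,2) by (intro Pi_pmf_union) (auto intro: finite_subset)
  moreover have "K \<union> (E - K) = E"
    using assms(2) by auto
  ultimately have E: "Pi_pmf E d p = map_pmf ?h (pair_pmf A B)"
    by simp
  have PQ: "P (?h (f, g)) = P f" "Q (?h (f, g)) = Q g" for f g
    by (rule P Q; simp)+
  \<comment> \<open>The product rule is stated for countable sets, hence the detour through the supports.\<close>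
  have prod: "measure_pmf.prob (pair_pmf A B) (X \<times> Y)
      = measure_pmf.prob A X * measure_pmf.prob B Y" for X Y
  proof -
    have "measure_pmf.prob (pair_pmf A B) (X \<times> Y)
        = measure_pmf.prob (pair_pmf A B) ((X \<times> Y) \<inter> set_pmf (pair_pmf A B))"
      by (simp only: measure_Int_set_pmf)
    also have "(X \<times> Y) \<inter> set_pmf (pair_pmf A B) = (X \<inter> set_pmf A) \<times> (Y \<inter> set_pmf B)"
      by auto
    also have "measure_pmf.prob (pair_pmf A B) \<dots> = measure_pmf.prob A X * measure_pmf.prob B Y"
      by (subst measure_pmf_prob_product) (auto simp: measure_Int_set_pmf)
    finally show ?thesis .
  qed
  have v: "?h -` {Z. P Z \<and> Q Z} = {Z. P Z} \<times> {Z. Q Z}"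
    "?h -` {Z. P Z} = {Z. P Z} \<times> UNIV" "?h -` {Z. Q Z} = UNIV \<times> {Z. Q Z}"
    using PQ by auto
  show ?thesis
    unfolding E measure_map_pmf v prod by simp
qed

lemma prob_indep_bits_all:
  assumes "finite E" "T \<subseteq> E" "\<And>e. e \<in> E \<Longrightarrow> 0 \<le> g e \<and> g e \<le> 1"
  shows "measure_pmf.prob (indep_bits E g) {Z. \<forall>e\<in>T. Z e} = (\<Prod>e\<in>T. g e)"
proof -
  have "{Z. \<forall>e\<in>T. Z e} = Pi E (\<lambda>e. if e \<in> T then {True} else UNIV)"
    using assms(2) by (auto simp: Pi_def)
  then have "measure_pmf.prob (indep_bits E g) {Z. \<forall>e\<in>T. Z e}
      = (\<Prod>e\<in>E. measure_pmf.prob (bernoulli_pmf (g e)) (if e \<in> T then {True} else UNIV))"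
    by (simp add: indep_bits_def measure_Pi_pmf_Pi[OF assms(1)])
  also have "\<dots> = (\<Prod>e\<in>E. if e \<in> T then g e else 1)"
    using assms(3) by (intro prod.cong) (auto simp: measure_pmf_single)
  also have "\<dots> = (\<Prod>e\<in>T. g e)"
    using assms(1,2) by (simp add: prod.If_cases Int_absorb1)
  finally show ?thesis .
qed

text \<open>Disjoint blocks are independent, so the probability that none of them is full is the product of
the factors \<open>1 - (\<Prod>e\<in>T i. g e)\<close>, and \<open>1 - x \<le> exp (- x)\<close>. Singleton blocks bound the probability that
a set of vertices is independent, two-element blocks the probability that no augmenting path exists.\<close>

lemma prob_no_block_le:
  fixes T :: "'i \<Rightarrow> 'a set"
  assumes "finite E" "finite I" and g: "\<And>e. e \<in> E \<Longrightarrow> 0 \<le> g e \<and> g e \<le> 1"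
    and "\<And>i. i \<in> I \<Longrightarrow> T i \<subseteq> E" and "disjoint_family_on T I"
  shows "measure_pmf.prob (indep_bits E g) {Z. \<forall>i\<in>I. \<not> (\<forall>e\<in>T i. Z e)}
    \<le> exp (- (\<Sum>i\<in>I. \<Prod>e\<in>T i. g e))"
  using assms(2,4,5)
proof (induction I rule: finite_induct)
  case (insert i I)
  have T: "T i \<subseteq> E" "T j \<subseteq> E - T i" if "j \<in> I" for j
    using insert.prems insert.hyps that by (auto simp: disjoint_family_on_def)
  have Ti: "T i \<subseteq> E"
    using insert.prems by auto
  have "measure_pmf.prob (indep_bits E g) {Z. \<not> (\<forall>e\<in>T i. Z e)}
      = 1 - measure_pmf.prob (indep_bits E g) {Z. \<forall>e\<in>T i. Z e}"
    by (subst measure_pmf.prob_compl[symmetric]) (auto intro!: arg_cong2[where f = measure])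
  also have "\<dots> = 1 - (\<Prod>e\<in>T i. g e)"
    by (simp add: prob_indep_bits_all[OF \<open>finite E\<close> Ti g])
  also have "\<dots> \<le> exp (- (\<Prod>e\<in>T i. g e))"
    using exp_ge_add_one_self[of "- (\<Prod>e\<in>T i. g e)"] by simp
  finally have 1: "measure_pmf.prob (indep_bits E g) {Z. \<not> (\<forall>e\<in>T i. Z e)}
      \<le> exp (- (\<Prod>e\<in>T i. g e))" .
  have 2: "measure_pmf.prob (indep_bits E g) {Z. \<forall>j\<in>I. \<not> (\<forall>e\<in>T j. Z e)}
      \<le> exp (- (\<Sum>j\<in>I. \<Prod>e\<in>T j. g e))"
    using insert.prems by (intro insert.IH) (auto simp: disjoint_family_on_def)
  have "measure_pmf.prob (indep_bits E g) {Z. \<forall>j\<in>insert i I. \<not> (\<forall>e\<in>T j. Z e)}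
      = measure_pmf.prob (indep_bits E g)
          {Z. \<not> (\<forall>e\<in>T i. Z e) \<and> (\<forall>j\<in>I. \<not> (\<forall>e\<in>T j. Z e))}"
    by simp
  also have "\<dots> = measure_pmf.prob (indep_bits E g) {Z. \<not> (\<forall>e\<in>T i. Z e)}
      * measure_pmf.prob (indep_bits E g) {Z. \<forall>j\<in>I. \<not> (\<forall>e\<in>T j. Z e)}"
    unfolding indep_bits_def
  proof (rule Pi_pmf_disjoint_coords_indep[OF \<open>finite E\<close> Ti])
    fix Z Z' :: "'a \<Rightarrow> bool"
    assume "\<And>e. e \<in> E - T i \<Longrightarrow> Z e = Z' e"
    then show "(\<forall>j\<in>I. \<not> (\<forall>e\<in>T j. Z e)) = (\<forall>j\<in>I. \<not> (\<forall>e\<in>T j. Z' e))"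
      using T(2) by (metis subsetD)
  qed auto
  also have "\<dots> \<le> exp (- (\<Prod>e\<in>T i. g e)) * exp (- (\<Sum>j\<in>I. \<Prod>e\<in>T j. g e))"
    using 1 2 by (intro mult_mono) auto
  finally show ?case
    using insert.hyps by (simp flip: exp_add)
qed simp

section \<open>Matchings as involutions and their augmentation\<close>

text \<open>A matching covering exactly \<open>V\<close>, given by the function that sends each covered vertex to its
partner. Both orientations of an edge are then reached by letting the covered vertex range
over \<open>V\<close>, and augmenting is a function update.\<close>

definition mates :: "'a set set \<Rightarrow> ('a \<Rightarrow> 'a) \<Rightarrow> 'a set \<Rightarrow> bool" where
  "mates G m V \<longleftrightarrow> (\<forall>a\<in>V. m a \<in> V \<and> m a \<noteq> a \<and> m (m a) = a \<and> {a, m a} \<in> G)"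

lemma mates_insert_edge:
  assumes "mates G m V" "a \<notin> V" "b \<notin> V" "a \<noteq> b" "{a, b} \<in> G"
  shows "mates G (m(a := b, b := a)) (insert a (insert b V))"
proof -
  have "{b, a} \<in> G"
    using assms(5) by (simp add: insert_commute)
  moreover have "m x \<noteq> a" "m x \<noteq> b" if "x \<in> V" for x
    using assms that by (auto simp: mates_def)
  ultimately show ?thesis
    using assms unfolding mates_def by auto
qed

text \<open>Flipping the path \<open>u, w, m w, v\<close>: the edge \<open>{w, m w}\<close> is removed first, and what remains is a matching
of \<open>V - {w, m w}\<close> to which the two outer edges are added.\<close>

lemma mates_augment:
  assumes m: "mates G m V" and uv: "u \<notin> V" "v \<notin> V" "u \<noteq> v"
    and "w \<in> V" and e: "{u, w} \<in> G" "{m w, v} \<in> G"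
  shows "mates G (m(u := w, w := u, v := m w, m w := v)) (insert u (insert v V))"
proof -
  have w: "m w \<in> V" "m w \<noteq> w" "m (m w) = w"
    using m \<open>w \<in> V\<close> by (auto simp: mates_def)
  have "mates G m (V - {w, m w})"
    unfolding mates_def
  proof (intro ballI conjI)
    fix a assume "a \<in> V - {w, m w}"
    then have a: "a \<in> V" "a \<noteq> w" "a \<noteq> m w"
      by auto
    have "m a \<noteq> w" "m a \<noteq> m w"
      using a w m unfolding mates_def by metis+
    then show "m a \<in> V - {w, m w}" "m a \<noteq> a" "m (m a) = a" "{a, m a} \<in> G"
      using a m by (auto simp: mates_def)
  qed
  then have "mates G (m(u := w, w := u)) (insert u (insert w (V - {w, m w})))"
    by (rule mates_insert_edge) (use uv w \<open>w \<in> V\<close> e in auto)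
  then have "mates G ((m(u := w, w := u))(v := m w, m w := v))
      (insert v (insert (m w) (insert u (insert w (V - {w, m w})))))"
    by (rule mates_insert_edge) (use uv w \<open>w \<in> V\<close> e in \<open>auto simp: insert_commute\<close>)
  moreover have "insert v (insert (m w) (insert u (insert w (V - {w, m w})))) = insert u (insert v V)"
    using w \<open>w \<in> V\<close> by auto
  ultimately show ?thesis
    by simp
qed

lemma mates_in_E_PER:
  assumes m: "mates G m V" and "card ({1..n} - V) \<le> 1"
  shows "G \<in> E_PER n"
proof -
  let ?W = "(\<lambda>a. {a, m a}) ` V"
  have "matching G ?W"
    unfolding matching_def
  proof (intro conjI ballI impI)
    show "?W \<subseteq> G"
      using m by (auto simp: mates_def)
    fix e f assume "e \<in> ?W" "f \<in> ?W" "e \<noteq> f"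
    then obtain a b where ab: "a \<in> V" "e = {a, m a}" "b \<in> V" "f = {b, m b}"
      by auto
    have "m a \<noteq> m b" if "a \<noteq> b"
      using that ab m unfolding mates_def by metis
    moreover have "m (m a) = a" "m (m b) = b"
      using ab m by (auto simp: mates_def)
    ultimately show "e \<inter> f = {}"
      using ab \<open>e \<noteq> f\<close> by auto
  qed
  moreover have "{v \<in> {1..n}. \<forall>e\<in>?W. v \<notin> e} = {1..n} - V"
    using m by (auto simp: mates_def)
  ultimately have "perfect_matching n G ?W"
    using assms(2) by (simp add: perfect_matching_def)
  then show ?thesis
    by (auto simp: E_PER_def)
qed

text \<open>The vertices left uncovered by a maximal matching span no edge.\<close>

lemma ex_large_mates:
  assumes "finite N"
    and edge: "\<And>U. U \<subseteq> N \<Longrightarrow> s \<le> card U \<Longrightarrow> \<exists>a\<in>U. \<exists>b\<in>U. a \<noteq> b \<and> {a, b} \<in> G"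
  obtains m V where "V \<subseteq> N" "mates G m V" "card (N - V) < s"
proof -
  let ?\<V> = "{V. V \<subseteq> N \<and> (\<exists>m. mates G m V)}"
  have "finite ?\<V>" "{} \<in> ?\<V>"
    using \<open>finite N\<close> by (auto simp: mates_def)
  then obtain V where V: "V \<in> ?\<V>" and max: "\<And>V'. V' \<in> ?\<V> \<Longrightarrow> V \<subseteq> V' \<Longrightarrow> V = V'"
    using finite_has_maximal[of ?\<V>] by (metis (no_types, lifting) empty_iff)
  then obtain m where m: "mates G m V"
    by auto
  have "card (N - V) < s"
  proof (rule ccontr)
    assume "\<not> card (N - V) < s"
    then obtain a b where ab: "a \<in> N - V" "b \<in> N - V" "a \<noteq> b" "{a, b} \<in> G"
      using edge[of "N - V"] by auto
    then have "insert a (insert b V) \<in> ?\<V>"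
      using mates_insert_edge[OF m, of a b] V by blast
    then show False
      using max[of "insert a (insert b V)"] ab by auto
  qed
  then show thesis
    using that V m by auto
qed

section \<open>Absorbing the uncovered vertices in pairs\<close>

lemma complete_edges_iff: "{u, v} \<in> complete_edges n \<longleftrightarrow> u \<in> {1..n} \<and> v \<in> {1..n} \<and> u \<noteq> v"
  by (auto simp: complete_edges_def doubleton_eq_iff)

text \<open>The pairs \<open>{{u, w}, {m w, v}}\<close> for \<open>w \<in> V\<close> are pairwise disjoint because \<open>m\<close> is injective on \<open>V\<close>. A
pair is useless only if \<open>w\<close> is one of the at most \<open>k\<close> weak neighbours of \<open>u\<close>, or \<open>m w\<close> one of the
at most \<open>k\<close> weak neighbours of \<open>v\<close>. All the others are full with probability at least \<open>t\<^sup>2\<close>.\<close>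

lemma prob_no_augmenting_path_le:
  fixes g :: "nat set \<Rightarrow> real"
  assumes g: "\<And>f. f \<in> complete_edges n \<Longrightarrow> 0 \<le> g f \<and> g f \<le> 1"
    and m: "mates G m V" and "V \<subseteq> {1..n}"
    and uv: "u \<in> {1..n} - V" "v \<in> {1..n} - V" "u \<noteq> v"
    and few: "\<And>x. x \<in> {u, v} \<Longrightarrow> card {w \<in> V. g {x, w} < t} \<le> k"
    and "0 \<le> t"
  shows "measure_pmf.prob (indep_bits (complete_edges n) g)
      {X. \<not> (\<exists>w\<in>V. X {u, w} \<and> X {m w, v})} \<le> exp (- ((real (card V) - 2 * real k) * t\<^sup>2))"
proof -
  have mV: "m w \<in> V" "m (m w) = w" if "w \<in> V" for w
    using m that by (auto simp: mates_def)
  have fin: "finite V"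
    using \<open>V \<subseteq> {1..n}\<close> finite_subset by blast
  have V: "w \<in> {1..n}" "w \<noteq> u" "w \<noteq> v" if "w \<in> V" for w
    using that \<open>V \<subseteq> {1..n}\<close> uv by auto
  have E: "{u, w} \<in> complete_edges n" "{m w, v} \<in> complete_edges n" if "w \<in> V" for w
    using V[OF that] V[OF mV(1)[OF that]] uv by (auto simp: complete_edges_iff)
  let ?T = "\<lambda>w. {{u, w}, {m w, v}}"
  have prodT: "(\<Prod>e\<in>?T w. g e) = g {u, w} * g {m w, v}" if "w \<in> V" for w
  proof -
    have "{u, w} \<noteq> {m w, v}"
      using V[OF that] V[OF mV(1)[OF that]] uv by (auto simp: doubleton_eq_iff)
    then show ?thesis
      by simp
  qed
  have "measure_pmf.prob (indep_bits (complete_edges n) g)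
      {X. \<forall>w\<in>V. \<not> (\<forall>e\<in>?T w. X e)} \<le> exp (- (\<Sum>w\<in>V. \<Prod>e\<in>?T w. g e))"
  proof (rule prob_no_block_le[OF finite_complete_edges fin g])
    show "?T w \<subseteq> complete_edges n" if "w \<in> V" for w
      using E that by auto
    show "disjoint_family_on ?T V"
      unfolding disjoint_family_on_def
    proof (intro ballI impI)
      fix w x assume wx: "w \<in> V" "x \<in> V" "w \<noteq> x"
      then have "m w \<noteq> m x"
        using mV(2) by metis
      then show "?T w \<inter> ?T x = {}"
        using wx V[OF wx(1)] V[OF wx(2)] V[OF mV(1)[OF wx(1)]] V[OF mV(1)[OF wx(2)]] uv
        by (auto simp: doubleton_eq_iff)
    qed
  qed auto
  also have "{X. \<forall>w\<in>V. \<not> (\<forall>e\<in>?T w. X e)} = {X. \<not> (\<exists>w\<in>V. X {u, w} \<and> X {m w, v})}"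
    by auto
  also have "(\<Sum>w\<in>V. \<Prod>e\<in>?T w. g e) = (\<Sum>w\<in>V. g {u, w} * g {m w, v})"
    by (rule sum.cong) (use prodT in auto)
  also have "exp (- (\<Sum>w\<in>V. g {u, w} * g {m w, v})) \<le> exp (- ((real (card V) - 2 * real k) * t\<^sup>2))"
  proof -
    let ?B = "\<lambda>x. {w \<in> V. g {x, w} < t}"
    let ?U = "?B u" and ?M = "{w \<in> V. m w \<in> ?B v}"
    have "card ?U \<le> k"
      using few[of u] by simp
    moreover have "card ?M \<le> k"
    proof -
      have "inj_on m ?M"
        by (rule inj_on_inverseI[of _ m]) (use mV in auto)
      then have "card ?M \<le> card (?B v)"
        using fin by (intro card_inj_on_le) auto
      then show ?thesis
        using few[of v] by auto
    qed
    ultimately have "card (?U \<union> ?M) \<le> 2 * k"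
      using card_Un_le[of ?U ?M] by linarith
    moreover have "card (V - (?U \<union> ?M)) = card V - card (?U \<union> ?M)" "card (?U \<union> ?M) \<le> card V"
      using fin by (auto intro!: card_Diff_subset card_mono intro: finite_subset)
    ultimately have "real (card V) - 2 * real k \<le> real (card (V - (?U \<union> ?M)))"
      by linarith
    then have "(real (card V) - 2 * real k) * t\<^sup>2 \<le> (\<Sum>w\<in>V - (?U \<union> ?M). t * t)"
      by (simp add: power2_eq_square mult_right_mono)
    also have "\<dots> \<le> (\<Sum>w\<in>V - (?U \<union> ?M). g {u, w} * g {m w, v})"
    proof (rule sum_mono)
      fix w assume w: "w \<in> V - (?U \<union> ?M)"
      then have "t \<le> g {u, w}" "t \<le> g {v, m w}"
        using V[of w] V[of "m w"] mV(1)[of w] by auto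
      then show "t * t \<le> g {u, w} * g {m w, v}"
        using \<open>0 \<le> t\<close> by (intro mult_mono) (auto simp: insert_commute)
    qed
    also have "\<dots> \<le> (\<Sum>w\<in>V. g {u, w} * g {m w, v})"
      using fin E g by (intro sum_mono2) auto
    finally show ?thesis
      by simp
  qed
  finally show ?thesis .
qed

text \<open>Two vertices are absorbed in each step. What has been revealed so far is recorded in \<open>g\<close> itself,
as probabilities zero and one, so that the matching found so far consists of sure edges. The
hypothesis on weak neighbours concerns uncovered vertices only. It survives a step because
nothing is revealed at those that stay uncovered.\<close>

lemma prob_complete_to_perfect_ge:
  fixes g :: "nat set \<Rightarrow> real"
  assumes "\<And>f. f \<in> complete_edges n \<Longrightarrow> 0 \<le> g f \<and> g f \<le> 1"
    and "mates {f \<in> complete_edges n. g f = 1} m V" and "V \<subseteq> {1..n}"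
    and "\<And>x. x \<in> {1..n} - V \<Longrightarrow> card {w \<in> {1..n} - {x}. g {x, w} < t} \<le> k"
    and "0 \<le> t" and "\<kappa> \<le> (real (card V) - 2 * real k) * t\<^sup>2"
  shows "measure_pmf.prob (indep_bits (complete_edges n) g)
      {Z. {f \<in> complete_edges n. Z f} \<in> E_PER n} \<ge> 1 - real (card ({1..n} - V)) * exp (- \<kappa>)"
  using assms
proof (induction "card ({1..n} - V)" arbitrary: g m V rule: less_induct)
  case less
  note g = less.prems(1) and m = less.prems(2) and V = less.prems(3) and few = less.prems(4)
  let ?E = "complete_edges n"
  let ?A = "{Z. {f \<in> ?E. Z f} \<in> E_PER n}"
  show ?case
  proof (cases "card ({1..n} - V) \<le> 1")
    case True
    have "Z \<in> ?A" if "\<forall>f\<in>?E. g f = 1 \<longrightarrow> Z f" for Z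
    proof -
      have "mates {f \<in> ?E. Z f} m V"
        using m that by (auto simp: mates_def)
      then show ?thesis
        using mates_in_E_PER True by blast
    qed
    then have "AE Z in measure_pmf (indep_bits ?E g). Z \<in> ?A"
      using AE_indep_bits_sure[OF finite_complete_edges, of n g] by (auto elim!: eventually_mono)
    then have "measure_pmf.prob (indep_bits ?E g) ?A = 1"
      by (subst measure_pmf.prob_eq_1) auto
    then show ?thesis
      by simp
  next
    case False
    then obtain u v where uv: "u \<in> {1..n} - V" "v \<in> {1..n} - V" "u \<noteq> v"
      by (metis card_le_Suc0_iff_eq finite_Diff finite_atLeastAtMost One_nat_def)
    (* Only the edges between {u, v} and V are revealed now; g' X is the law of the rest. *)
    define F where "F = {{x, w} | x w. x \<in> {u, v} \<and> w \<in> V}"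
    define a b where "a = (\<lambda>f. if f \<in> F then g f else 0)" and "b = (\<lambda>f. if f \<in> F then 0 else g f)"
    define g' where "g' = (\<lambda>X f. if X f then 1 else b f)"
    have rounds: "indep_bits ?E g = bind_pmf (indep_bits ?E a) (\<lambda>X. indep_bits ?E (g' X))"
      unfolding g'_def using g
      by (intro indep_bits_two_rounds finite_complete_edges) (auto simp: a_def b_def)
    have "measure_pmf.prob (bind_pmf (indep_bits ?E a) (\<lambda>X. indep_bits ?E (g' X))) ?A
        \<ge> 1 - exp (- \<kappa>) - real (card ({1..n} - V) - 2) * exp (- \<kappa>)"
    proof (rule prob_bind_ge)
      have agV: "a {x, w} = g {x, w}" if "x \<in> {u, v}" "w \<in> V" for x w
        using that by (auto simp: a_def F_def)
      have "card {w \<in> V. a {x, w} < t} \<le> k" if x: "x \<in> {u, v}" for x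
      proof -
        have "{w \<in> V. a {x, w} < t} \<subseteq> {w \<in> {1..n} - {x}. g {x, w} < t}"
          using agV[OF x] x uv V by auto
        then have "card {w \<in> V. a {x, w} < t} \<le> card {w \<in> {1..n} - {x}. g {x, w} < t}"
          by (intro card_mono) auto
        also have "\<dots> \<le> k"
          using few x uv by auto
        finally show ?thesis .
      qed
      then have "measure_pmf.prob (indep_bits ?E a) {X. \<not> (\<exists>w\<in>V. X {u, w} \<and> X {m w, v})}
          \<le> exp (- ((real (card V) - 2 * real k) * t\<^sup>2))"
        using g less.prems(5) by (intro prob_no_augmenting_path_le[OF _ m V uv]) (auto simp: a_def)
      also have "\<dots> \<le> exp (- \<kappa>)"
        using less.prems(6) by simp
      finally show "measure_pmf.prob (indep_bits ?E a) {X. \<not> (\<exists>w\<in>V. X {u, w} \<and> X {m w, v})}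
          \<le> exp (- \<kappa>)" .
    next
      fix X assume "\<exists>w\<in>V. X {u, w} \<and> X {m w, v}"
      then obtain w where w: "w \<in> V" "X {u, w}" "X {m w, v}"
        by auto
      have "m w \<in> V"
        using m w by (auto simp: mates_def)
      let ?V = "insert u (insert v V)"
      have unF: "f \<notin> F" if "f \<subseteq> V" for f
        using that uv by (auto simp: F_def)
      have card: "card ({1..n} - ?V) = card ({1..n} - V) - 2"
      proof -
        have "{1..n} - ?V = {1..n} - V - {u, v}"
          by auto
        then show ?thesis
          using uv by (simp add: card_Diff_subset)
      qed
      have cV: "card V \<le> card ?V"
        using V by (intro card_mono) (auto intro: finite_subset)
      have "measure_pmf.prob (indep_bits ?E (g' X)) ?A \<ge> 1 - real (card ({1..n} - ?V)) * exp (- \<kappa>)"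
      proof (rule less.hyps)
        show "card ({1..n} - ?V) < card ({1..n} - V)"
          using card False by simp
        show "0 \<le> g' X f \<and> g' X f \<le> 1" if "f \<in> ?E" for f
          using g that by (auto simp: g'_def b_def)
        have "g' X {x, m x} = 1" if "x \<in> V" for x
        proof -
          have "m x \<in> V" "g {x, m x} = 1"
            using m that by (auto simp: mates_def)
          then show ?thesis
            using unF[of "{x, m x}"] that by (auto simp: g'_def b_def)
        qed
        then have "mates {f \<in> ?E. g' X f = 1} m V"
          using m by (auto simp: mates_def)
        then show "mates {f \<in> ?E. g' X f = 1} (m(u := w, w := u, v := m w, m w := v)) ?V"
          using uv w \<open>m w \<in> V\<close> V
          by (intro mates_augment) (auto simp: g'_def complete_edges_iff)
        show "?V \<subseteq> {1..n}"
          using uv V by auto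
        fix x assume x: "x \<in> {1..n} - ?V"
        have "g {x, y} \<le> g' X {x, y}" if "y \<in> {1..n} - {x}" for y
        proof -
          have "{x, y} \<notin> F"
            using x by (auto simp: F_def doubleton_eq_iff)
          then show ?thesis
            using g[of "{x, y}"] x that by (auto simp: g'_def b_def complete_edges_iff)
        qed
        then have "card {y \<in> {1..n} - {x}. g' X {x, y} < t} \<le> card {y \<in> {1..n} - {x}. g {x, y} < t}"
          by (intro card_mono) force+
        also have "\<dots> \<le> k"
          using few x by auto
        finally show "card {y \<in> {1..n} - {x}. g' X {x, y} < t} \<le> k" .
      next
        show "0 \<le> t"
          by fact
        show "\<kappa> \<le> (real (card ?V) - 2 * real k) * t\<^sup>2"
          using less.prems(6) cV mult_right_mono[of "real (card V) - 2 * real k" "real (card ?V) - 2 * real k" "t\<^sup>2"]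
          by auto
      qed
      then show "measure_pmf.prob (indep_bits ?E (g' X)) ?A
          \<ge> 1 - real (card ({1..n} - V) - 2) * exp (- \<kappa>)"
        using card by simp
    qed simp
    moreover have "real (card ({1..n} - V) - 2) * exp (- \<kappa>)
        = real (card ({1..n} - V)) * exp (- \<kappa>) - 2 * exp (- \<kappa>)"
      using False by (simp add: of_nat_diff left_diff_distrib)
    ultimately show ?thesis
      using exp_ge_zero[of "- \<kappa>"] unfolding rounds by linarith
  qed
qed

section \<open>Independent sets\<close>

text \<open>It is enough to look at the edges between \<open>B\<close> and \<open>U - B\<close>, which spares double counting: for \<open>B\<close>
just large enough for the niceness condition, every vertex of \<open>U - B\<close> contributes a full row sum.\<close>

lemma prob_independent_le:
  fixes g :: "nat set \<Rightarrow> real"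
  assumes g: "\<And>f. f \<in> complete_edges n \<Longrightarrow> 0 \<le> g f \<and> g f \<le> 1"
    and "U \<subseteq> {1..n}" "B \<subseteq> U"
  shows "measure_pmf.prob (indep_bits (complete_edges n) g)
      {X. \<forall>x\<in>U. \<forall>y\<in>U. x \<noteq> y \<longrightarrow> \<not> X {x, y}} \<le> exp (- (\<Sum>x\<in>U - B. \<Sum>y\<in>B. g {x, y}))"
proof -
  let ?I = "(U - B) \<times> B" and ?T = "\<lambda>(x, y). {{x, y}}"
  have fin: "finite ?I" "finite (U - B)" "finite B"
    using finite_subset[of U "{1..n}"] finite_subset[of B U] assms(2,3) by auto
  have "measure_pmf.prob (indep_bits (complete_edges n) g)
      {X. \<forall>x\<in>U. \<forall>y\<in>U. x \<noteq> y \<longrightarrow> \<not> X {x, y}}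
    \<le> measure_pmf.prob (indep_bits (complete_edges n) g) {X. \<forall>i\<in>?I. \<not> (\<forall>e\<in>?T i. X e)}"
  proof (rule measure_pmf.finite_measure_mono)
    show "{X. \<forall>x\<in>U. \<forall>y\<in>U. x \<noteq> y \<longrightarrow> \<not> X {x, y}} \<subseteq> {X. \<forall>i\<in>?I. \<not> (\<forall>e\<in>?T i. X e)}"
    proof clarsimp
      fix X :: "nat set \<Rightarrow> bool" and x y
      assume "\<forall>x\<in>U. \<forall>y\<in>U. x \<noteq> y \<longrightarrow> \<not> X {x, y}" "x \<in> U" "x \<notin> B" "y \<in> B" "X {x, y}"
      then show False
        using subsetD[OF \<open>B \<subseteq> U\<close>, of y] by metis
    qed
  qed simp
  also have "\<dots> \<le> exp (- (\<Sum>i\<in>?I. \<Prod>e\<in>?T i. g e))"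
  proof (rule prob_no_block_le[OF finite_complete_edges fin(1) g])
    show "?T i \<subseteq> complete_edges n" if "i \<in> ?I" for i
    proof -
      obtain x y where "i = (x, y)" "x \<in> U" "x \<notin> B" "y \<in> B"
        using \<open>i \<in> ?I\<close> by (cases i) auto
      moreover from this have "x \<in> {1..n}" "y \<in> {1..n}" "x \<noteq> y"
        using assms(2,3) by blast+
      ultimately show ?thesis
        by (simp add: complete_edges_iff)
    qed
    show "disjoint_family_on ?T ?I"
      by (auto simp: disjoint_family_on_def doubleton_eq_iff)
  qed auto
  also have "(\<Sum>i\<in>?I. \<Prod>e\<in>?T i. g e) = (\<Sum>x\<in>U - B. \<Sum>y\<in>B. g {x, y})"
    using fin by (simp add: sum.cartesian_product case_prod_beta)
  finally show ?thesis .
qed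

lemma prob_large_independent_le:
  fixes g :: "nat set \<Rightarrow> real"
  assumes g: "\<And>f. f \<in> complete_edges n \<Longrightarrow> 0 \<le> g f \<and> g f \<le> 1"
    and row: "\<And>x B. x \<in> {1..n} \<Longrightarrow> B \<subseteq> {1..n} - {x} \<Longrightarrow> card B = r \<Longrightarrow> c \<le> (\<Sum>y\<in>B. g {x, y})"
    and "r \<le> s" "0 \<le> c"
  shows "measure_pmf.prob (indep_bits (complete_edges n) g)
      {X. \<exists>U\<subseteq>{1..n}. s \<le> card U \<and> (\<forall>x\<in>U. \<forall>y\<in>U. x \<noteq> y \<longrightarrow> \<not> X {x, y})}
    \<le> 2 ^ n * exp (- ((real s - real r) * c))"
proof -
  let ?M = "measure_pmf.prob (indep_bits (complete_edges n) g)"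
  let ?\<U> = "{U. U \<subseteq> {1..n} \<and> s \<le> card U}"
  let ?ind = "\<lambda>U. {X. \<forall>x\<in>U. \<forall>y\<in>U. x \<noteq> y \<longrightarrow> \<not> X {x, y}}"
  have single: "?M (?ind U) \<le> exp (- ((real s - real r) * c))" if U: "U \<in> ?\<U>" for U
  proof -
    obtain B where B: "B \<subseteq> U" "card B = r" "finite B"
      using obtain_subset_with_card_n[of r U] U \<open>r \<le> s\<close> by auto
    have "real s - real r \<le> real (card (U - B))"
      using U B card_Diff_subset[of B U] by auto
    then have "(real s - real r) * c \<le> real (card (U - B)) * c"
      using \<open>0 \<le> c\<close> by (rule mult_right_mono)
    also have "\<dots> = (\<Sum>x\<in>U - B. c)"
      by simp
    also have "\<dots> \<le> (\<Sum>x\<in>U - B. \<Sum>y\<in>B. g {x, y})"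
      using U B by (intro sum_mono row) auto
    finally have "exp (- (\<Sum>x\<in>U - B. \<Sum>y\<in>B. g {x, y})) \<le> exp (- ((real s - real r) * c))"
      by simp
    moreover have "?M (?ind U) \<le> exp (- (\<Sum>x\<in>U - B. \<Sum>y\<in>B. g {x, y}))"
      using U B by (intro prob_independent_le g) auto
    ultimately show ?thesis
      by (rule order_trans[rotated])
  qed
  have "{X. \<exists>U\<subseteq>{1..n}. s \<le> card U \<and> (\<forall>x\<in>U. \<forall>y\<in>U. x \<noteq> y \<longrightarrow> \<not> X {x, y})} = (\<Union>U\<in>?\<U>. ?ind U)"
    by auto
  also have "?M \<dots> \<le> (\<Sum>U\<in>?\<U>. ?M (?ind U))"
    by (rule measure_pmf.finite_measure_subadditive_finite) auto
  also have "\<dots> \<le> (\<Sum>U\<in>?\<U>. exp (- ((real s - real r) * c)))"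
    using single by (rule sum_mono)
  also have "\<dots> \<le> 2 ^ n * exp (- ((real s - real r) * c))"
  proof -
    have "card ?\<U> \<le> card (Pow {1..n})"
      by (intro card_mono) auto
    also have "\<dots> = 2 ^ n"
      by (simp add: card_Pow)
    finally have "real (card ?\<U>) \<le> real (2 ^ n)"
      by (simp only: of_nat_le_iff)
    then show ?thesis
      by (simp add: mult_right_mono)
  qed
  finally show ?thesis .
qed

section \<open>Perfect matchings under nice edge probabilities\<close>

text \<open>The other vertex \<open>v\<close> and the second set in the niceness condition are auxiliary. The size bound
on \<open>r\<close> leaves room to choose them outside \<open>B\<close>.\<close>

lemma nice_row_sum:
  assumes "nice n \<beta> d1 d2 p q" "u \<in> {1..n}" "B \<subseteq> {1..n} - {u}" "card B = r"
    and "\<beta> * real n \<le> real r" and r: "2 * r + 2 \<le> n"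
  shows "d1 * real r * p \<le> (\<Sum>w\<in>B. q u w)"
proof -
  have fB: "finite B"
    using assms(3) finite_subset by blast
  have c: "card ({1..n} - {u} - B) = n - 1 - r"
    using assms fB by (subst card_Diff_subset) auto
  then have "0 < card ({1..n} - {u} - B)"
    using r by linarith
  then have "{1..n} - {u} - B \<noteq> {}"
    unfolding card_gt_0_iff by blast
  then obtain v where "v \<in> {1..n} - {u} - B"
    by blast
  then have v: "v \<in> {1..n}" "v \<noteq> u" "v \<notin> B"
    by auto
  have "card ({1..n} - {u} - B - {v}) = n - 2 - r"
    using v c by (subst card_Diff_singleton) auto
  then have "r \<le> card ({1..n} - {u} - B - {v})"
    using r by linarith
  from obtain_subset_with_card_n[OF this]
  obtain S where S: "S \<subseteq> {1..n} - {u} - B - {v}" "card S = r"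
    by blast
  have "B \<subseteq> {1..n} - {u, v}" "S \<subseteq> {1..n} - {u, v}" "B \<inter> S = {}"
    using assms(3) v S by auto
  then show ?thesis
    using assms(1)[unfolded nice_def, rule_format, OF assms(2) v(1) v(2)[symmetric], of B S r]
      assms(4,5) S(2) by simp
qed

text \<open>Otherwise \<open>r\<close> weak neighbours would together violate the lower bound for their row sum.\<close>

lemma nice_few_weak:
  assumes "nice n \<beta> d1 d2 p q" "u \<in> {1..n}"
    and "\<beta> * real n \<le> real r" "2 * r + 2 \<le> n" "0 < r"
  shows "card {w \<in> {1..n} - {u}. q u w < d1 * p} < r"
proof (rule ccontr)
  assume "\<not> ?thesis"
  then obtain B where B: "B \<subseteq> {w \<in> {1..n} - {u}. q u w < d1 * p}" "card B = r" "finite B"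
    using obtain_subset_with_card_n[of r "{w \<in> {1..n} - {u}. q u w < d1 * p}"] by auto
  have "(\<Sum>w\<in>B. q u w) < (\<Sum>w\<in>B. d1 * p)"
    using B \<open>0 < r\<close> by (intro sum_strict_mono) auto
  also have "\<dots> = d1 * real r * p"
    using B(2) by simp
  finally have "(\<Sum>w\<in>B. q u w) < d1 * real r * p" .
  moreover have "B \<subseteq> {1..n} - {u}"
    using B(1) by blast
  ultimately show False
    using nice_row_sum[OF assms(1,2) _ B(2) assms(3,4)] by force
qed

text \<open>The first error term comes from large independent sets in the first round, the second from the
at most \<open>n\<close> absorption steps. Independent sets are excluded from size \<open>n/3\<close> on: this exceeds
\<open>\<beta> n\<close> by at least \<open>n/12\<close>, which leaves \<open>n/24\<close> vertices outside a set \<open>B\<close> of size \<open>\<beta> n\<close> after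
rounding (here \<open>n \<ge> 24\<close> enters), and the covered part of size \<open>2n/3\<close> still exceeds the \<open>n/2\<close> vertices
that may be weak for one of two vertices.\<close>

lemma prob_E_PER_ge:
  fixes \<beta> d1 d2 p :: real
  assumes \<beta>: "0 < \<beta>" "\<beta> \<le> 1 / 4" and d1: "0 < d1" and n: "24 \<le> n" and p: "0 \<le> p"
    and q: "edge_prob_assignment n q" and nice: "nice n \<beta> d1 d2 p q"
  shows "measure_pmf.prob (random_graph n q) (E_PER n)
    \<ge> 1 - 2 ^ n * exp (- (d1 * \<beta> / 48 * (real n)\<^sup>2 * p)) - real n * exp (- (d1\<^sup>2 / 24 * (real n * p\<^sup>2)))"
proof -
  let ?E = "complete_edges n"
  define g where "g = (\<lambda>f. q (Min f) (Max f))"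
  have gq: "g {x, y} = q x y" if "x \<in> {1..n}" "y \<in> {1..n} - {x}" for x y
  proof -
    have "q y x = q x y"
      using q[unfolded edge_prob_assignment_def, rule_format, of x y] that by auto
    then show ?thesis
      unfolding g_def by (cases "x \<le> y") simp_all
  qed
  have g: "0 \<le> g f \<and> g f \<le> 1" if "f \<in> ?E" for f
  proof -
    obtain x y where xy: "f = {x, y}" "x \<in> {1..n}" "y \<in> {1..n}" "x \<noteq> y"
      using \<open>f \<in> ?E\<close> unfolding complete_edges_def by blast
    then have "0 \<le> q x y \<and> q x y \<le> 1"
      using q[unfolded edge_prob_assignment_def, rule_format, of x y] by auto
    then show ?thesis
      using gq[of x y] xy by simp
  qed
  define r where "r = nat \<lceil>\<beta> * real n\<rceil>"
  define s where "s = nat \<lceil>real n / 3\<rceil>"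
  have "0 < \<beta> * real n"
    using \<beta> n by simp
  then have r: "0 < r" "\<beta> * real n \<le> real r" "real r < \<beta> * real n + 1"
    unfolding r_def by linarith+
  have "\<beta> * real n \<le> 1 / 4 * real n"
    using \<beta> by (intro mult_right_mono) auto
  then have r4: "real r < real n / 4 + 1"
    using r by simp
  have rn: "2 * r + 2 \<le> n"
    using r4 n by linarith
  have s: "real n / 3 \<le> real s" "real s < real n / 3 + 1"
    unfolding s_def by linarith+
  have rs: "real n / 24 \<le> real s - real r" "r \<le> s"
    using r4 s n by linarith+
  (* The second-round probability b solves 1 - g = (1 - g/2) * (1 - b). It is at least g/2
     because (1 - g/2)^2 \<ge> 1 - g. *)
  define a where "a = (\<lambda>f. g f / 2)"
  define b where "b = (\<lambda>f. 1 - (1 - g f) / (1 - g f / 2))"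
  have a: "0 \<le> a f \<and> a f \<le> 1" if "f \<in> ?E" for f
    using g[OF that] by (auto simp: a_def)
  have b: "g f / 2 \<le> b f" "b f \<le> 1" "1 - g f = (1 - a f) * (1 - b f)" if "f \<in> ?E" for f
  proof -
    have *: "0 \<le> g f" "g f \<le> 1"
      using g[OF that] by auto
    then have "1 - g f \<le> (1 - g f / 2) * (1 - g f / 2)"
      by (simp add: algebra_simps)
    then show "g f / 2 \<le> b f"
      using * by (simp add: b_def field_simps)
    show "b f \<le> 1" "1 - g f = (1 - a f) * (1 - b f)"
      using * by (auto simp: a_def b_def)
  qed
  have b0: "0 \<le> b f" if "f \<in> ?E" for f
    using b(1)[OF that] g[OF that] by linarith
  define g' where "g' = (\<lambda>X f. if X f then 1 else b f)"
  let ?A = "{Z. {f \<in> ?E. Z f} \<in> E_PER n}"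
  let ?\<kappa> = "d1\<^sup>2 / 24 * (real n * p\<^sup>2)"
  have "measure_pmf.prob (random_graph n q) (E_PER n) = measure_pmf.prob (indep_bits ?E g) ?A"
    by (simp add: random_graph_def edge_indicators_def indep_bits_def g_def vimage_def)
  also have "indep_bits ?E g = bind_pmf (indep_bits ?E a) (\<lambda>X. indep_bits ?E (g' X))"
    unfolding g'_def using a b b0 by (intro indep_bits_two_rounds finite_complete_edges) auto
  also have "measure_pmf.prob \<dots> ?A
      \<ge> 1 - 2 ^ n * exp (- (d1 * \<beta> / 48 * (real n)\<^sup>2 * p)) - real n * exp (- ?\<kappa>)"
  proof (rule prob_bind_ge)
    let ?c = "d1 * \<beta> * real n * p / 2"
    have "measure_pmf.prob (indep_bits ?E a)
        {X. \<exists>U\<subseteq>{1..n}. s \<le> card U \<and> (\<forall>x\<in>U. \<forall>y\<in>U. x \<noteq> y \<longrightarrow> \<not> X {x, y})}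
      \<le> 2 ^ n * exp (- ((real s - real r) * ?c))"
    proof (rule prob_large_independent_le[OF a])
      fix x B assume xB: "x \<in> {1..n}" "B \<subseteq> {1..n} - {x}" "card B = r"
      have "(d1 * p) * (\<beta> * real n) \<le> (d1 * p) * real r"
        using r d1 p by (intro mult_left_mono) auto
      also have "\<dots> \<le> (\<Sum>y\<in>B. q x y)"
        using nice_row_sum[OF nice xB r(2) rn] by (simp add: mult_ac)
      also have "\<dots> = (\<Sum>y\<in>B. g {x, y})"
        using gq[OF xB(1)] subsetD[OF xB(2)] by (intro sum.cong) simp_all
      finally show "?c \<le> (\<Sum>y\<in>B. a {x, y})"
        by (simp add: a_def mult_ac flip: sum_divide_distrib)
    qed (use rs d1 p \<beta> in auto)
    also have "\<dots> \<le> 2 ^ n * exp (- (real n / 24 * ?c))"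
    proof -
      have "real n / 24 * ?c \<le> (real s - real r) * ?c"
        by (rule mult_right_mono) (use rs d1 p \<beta> in auto)
      then show ?thesis
        by (intro mult_left_mono) (simp_all only: exp_le_cancel_iff neg_le_iff_le zero_le_power zero_le_numeral)
    qed
    also have "real n / 24 * ?c = d1 * \<beta> / 48 * (real n)\<^sup>2 * p"
      by (simp add: power2_eq_square)
    finally show "measure_pmf.prob (indep_bits ?E a)
        {X. \<not> \<not> (\<exists>U\<subseteq>{1..n}. s \<le> card U \<and> (\<forall>x\<in>U. \<forall>y\<in>U. x \<noteq> y \<longrightarrow> \<not> X {x, y}))}
      \<le> 2 ^ n * exp (- (d1 * \<beta> / 48 * (real n)\<^sup>2 * p))"
      by (simp only: not_not)
  next
    fix X :: "nat set \<Rightarrow> bool"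
    assume X: "\<not> (\<exists>U\<subseteq>{1..n}. s \<le> card U \<and> (\<forall>x\<in>U. \<forall>y\<in>U. x \<noteq> y \<longrightarrow> \<not> X {x, y}))"
    obtain m V where V: "V \<subseteq> {1..n}" "mates {f \<in> ?E. X f} m V" "card ({1..n} - V) < s"
    proof (rule ex_large_mates[where N = "{1..n}" and s = s and G = "{f \<in> ?E. X f}"])
      fix U assume U: "U \<subseteq> {1..n}" "s \<le> card U"
      then obtain x y where "x \<in> U" "y \<in> U" "x \<noteq> y" "X {x, y}"
        using X by metis
      moreover from this have "{x, y} \<in> ?E"
        using subsetD[OF U(1)] by (simp add: complete_edges_iff)
      ultimately show "\<exists>x\<in>U. \<exists>y\<in>U. x \<noteq> y \<and> {x, y} \<in> {f \<in> ?E. X f}"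
        by blast
    qed auto
    have "card ({1..n} - V) = n - card V" "card V \<le> n"
      using V(1) card_mono[OF _ V(1)] by (auto simp: card_Diff_subset finite_subset)
    then have cV: "2 / 3 * real n < real (card V)"
      using V(3) s unfolding s_def by linarith
    have "measure_pmf.prob (indep_bits ?E (g' X)) ?A
        \<ge> 1 - real (card ({1..n} - V)) * exp (- ?\<kappa>)"
    proof (rule prob_complete_to_perfect_ge[where t = "d1 * p / 2" and k = "r - 1"])
      show "0 \<le> g' X f \<and> g' X f \<le> 1" if "f \<in> ?E" for f
        using b0 b that by (auto simp: g'_def)
      show "mates {f \<in> ?E. g' X f = 1} m V"
        using V(2) by (auto simp: mates_def g'_def)
      fix x assume x: "x \<in> {1..n} - V"
      have "q x w < d1 * p" if w: "w \<in> {1..n} - {x}" "g' X {x, w} < d1 * p / 2" for w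
      proof -
        have "{x, w} \<in> ?E"
          using x w by (auto simp: complete_edges_iff)
        then have "g {x, w} / 2 \<le> g' X {x, w}"
          using b(1)[of "{x, w}"] g[of "{x, w}"] by (auto simp: g'_def)
        then show ?thesis
          using w gq[of x w] x by auto
      qed
      then have "card {w \<in> {1..n} - {x}. g' X {x, w} < d1 * p / 2}
          \<le> card {w \<in> {1..n} - {x}. q x w < d1 * p}"
        by (intro card_mono) auto
      then show "card {w \<in> {1..n} - {x}. g' X {x, w} < d1 * p / 2} \<le> r - 1"
        using nice_few_weak[OF nice _ r(2) rn r(1), of x] x by auto
    next
      have "real n / 6 \<le> real (card V) - 2 * real (r - 1)"
        using cV r4 r(1) by linarith
      then have "real n / 6 * (d1 * p / 2)\<^sup>2 \<le> (real (card V) - 2 * real (r - 1)) * (d1 * p / 2)\<^sup>2"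
        by (rule mult_right_mono) simp
      then show "?\<kappa> \<le> (real (card V) - 2 * real (r - 1)) * (d1 * p / 2)\<^sup>2"
        by (simp add: power_mult_distrib power_divide)
    qed (use V d1 p in auto)
    moreover have "card ({1..n} - V) \<le> n"
      using card_mono[of "{1..n}" "{1..n} - V"] by auto
    then have "real (card ({1..n} - V)) * exp (- ?\<kappa>) \<le> real n * exp (- ?\<kappa>)"
      by (intro mult_right_mono) auto
    ultimately show "measure_pmf.prob (indep_bits ?E (g' X)) ?A \<ge> 1 - real n * exp (- ?\<kappa>)"
      by linarith
  qed simp
  finally show ?thesis .
qed

text \<open>The first exponent is of order \<open>n powr (3/2) * ln n\<close> and dominates \<open>n * ln 2\<close>. In the second summand
half of the exponent pays for the factor \<open>n = exp (ln n)\<close>.\<close>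

lemma eventually_failure_bound:
  fixes c D :: real
  assumes "0 < c" "0 < D"
  shows "\<forall>\<^sub>F n in sequentially.
    2 ^ n * exp (- (c * (real n)\<^sup>2 * (ln (real n) / sqrt (real n))))
      + real n * exp (- (2 * D * (ln (real n))\<^sup>2)) \<le> exp (- D * (ln (real n))\<^sup>2)"
  using assms by real_asymp

theorem theorem2:
  fixes \<beta> d1 d2 :: real
  assumes "0 < \<beta>" and "\<beta> < 1" and "0 < d1" and "0 < d2" and "\<beta> \<le> 1 / 4"
  shows "\<exists>D>0. \<exists>n0::nat. \<forall>n\<ge>n0. \<forall>p::real. \<forall>q::nat \<Rightarrow> nat \<Rightarrow> real.
           ln (real n) / sqrt (real n) \<le> p \<and> p < 1 \<and>
           edge_prob_assignment n q \<and> nice n \<beta> d1 d2 p q \<longrightarrow>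
             measure_pmf.prob (random_graph n q) (E_PER n) \<ge> 1 - exp (- D * (ln (real n))\<^sup>2)"
proof -
  define c D where "c = d1 * \<beta> / 48" and "D = d1\<^sup>2 / 48"
  have "0 < c" "0 < D"
    using assms by (auto simp: c_def D_def)
  from eventually_failure_bound[OF this] obtain n1 where n1: "\<And>n. n \<ge> n1 \<Longrightarrow>
      2 ^ n * exp (- (c * (real n)\<^sup>2 * (ln (real n) / sqrt (real n))))
        + real n * exp (- (2 * D * (ln (real n))\<^sup>2)) \<le> exp (- D * (ln (real n))\<^sup>2)"
    by (auto simp: eventually_sequentially)
  have "measure_pmf.prob (random_graph n q) (E_PER n) \<ge> 1 - exp (- D * (ln (real n))\<^sup>2)"
    if n: "n \<ge> max n1 24" and p: "ln (real n) / sqrt (real n) \<le> p"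
      and q: "edge_prob_assignment n q" "nice n \<beta> d1 d2 p q" for n p q
  proof -
    define l where "l = ln (real n) / sqrt (real n)"
    have l: "0 \<le> l" "l \<le> p"
      using n p by (auto simp: l_def)
    have "2 ^ n * exp (- (c * (real n)\<^sup>2 * p)) \<le> 2 ^ n * exp (- (c * (real n)\<^sup>2 * l))"
      using l \<open>0 < c\<close> by (simp add: mult_left_mono)
    moreover have "real n * exp (- (2 * D * (real n * p\<^sup>2))) \<le> real n * exp (- (2 * D * (ln (real n))\<^sup>2))"
    proof -
      have "(ln (real n))\<^sup>2 = real n * l\<^sup>2"
        using n by (simp add: l_def power_divide)
      also have "\<dots> \<le> real n * p\<^sup>2"
        using l by (intro mult_left_mono power_mono) auto
      finally show ?thesis
        using \<open>0 < D\<close> by (simp add: mult_left_mono)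
    qed
    moreover have "1 - 2 ^ n * exp (- (c * (real n)\<^sup>2 * p)) - real n * exp (- (2 * D * (real n * p\<^sup>2)))
        \<le> measure_pmf.prob (random_graph n q) (E_PER n)"
      using prob_E_PER_ge[OF assms(1,5,3) _ _ q] n l by (simp add: c_def D_def)
    ultimately show ?thesis
      using n1[of n, folded l_def] n by linarith
  qed
  with \<open>0 < D\<close> show ?thesis
    by blast
qed

end
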